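(* Let $m$ be a state-measure on a unital pseudo-BCK algebra $(A,u)$ that is downwards-directed, and let $m_u$ be the restriction of $m$ to the pseudo-BCK algebra $[u,1]$. The following statements are equivalent: (a) $m$ is a state-measure-morphism on $(A,u)$; (b) $m_u$ is a state-measure-morphism on $[u,1]$; (c) $\mathrm{Ker}_0(m)$ is a maximal filter of $A$; (d) $\mathrm{Ker}_0(m_u)$ is a maximal filter of $[u,1]$; (e) $m$ is an extremal state-measure on $(A,u)$; (f) $m_u$ is an extremal state-measure on $[u,1]$.
   Context: A pseudo-BCK algebra is a structure $(A,\le,\rightarrow,\rightsquigarrow,1)$ with $\le$ a binary relation, $\rightarrow,\rightsquigarrow$ binary operations and $1\in A$, such that for all $x,y,z\in A$: $x\rightarrow y\le (y\rightarrow z)\rightsquigarrow(x\rightarrow z)$ and $x\rightsquigarrow y\le (y\rightsquigarrow z)\rightarrow(x\rightsquigarrow z)$; $x\le (x\rightarrow y)\rightsquigarrow y$ and $x\le (x\rightsquigarrow y)\rightarrow y$; $x\le x$; $x\le 1$; antisymmetry of $\le$; $x\le y$ iff $x\rightarrow y=1$ iff $x\rightsquigarrow y=1$. It is downwards-directed if any two elements have a common lower bound. Put $x\rightarrow^0 y=y$, $x\rightarrow^n y=x\rightarrow(x\rightarrow^{n-1}y)$; $u$ is a strong unit if for every $a$ there is $n\ge1$ with $u\rightarrow^n a=1$; $(A,u)$ with $u$ a fixed strong unit is a unital pseudo-BCK algebra. For $u\in A$, $([u,1],\le,\rightarrow,\rightsquigarrow,u,1)$ is a bounded pseudo-BCK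 algebra with least element $u$. A measure is a map $m:A\to[0,\infty)$ with $m(x\rightarrow y)=m(x\rightsquigarrow y)=m(y)-m(x)$ whenever $y\le x$; a measure-morphism satisfies $m(x\rightarrow y)=m(x\rightsquigarrow y)=\max\{0,m(y)-m(x)\}$ for all $x,y$. A state-measure on $(A,u)$ (resp. on the bounded algebra $[u,1]$ with least element $u$) is a measure with value $1$ at $u$; a state-measure-morphism is a state-measure that is a measure-morphism. A state-measure $m$ is extremal if $m=\lambda m_1+(1-\lambda)m_2$ with $\lambda\in(0,1)$ and state-measures $m_1,m_2$ implies $m=m_1=m_2$. $\mathrm{Ker}_0(m)=\{x:m(x)=0\}$. A filter is a set $F\ni1$ with $a,a\rightarrow b\in F\Rightarrow b\in F$; it is maximal if proper and not properly contained in another proper filter. *)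

theory Defs
  imports Complex_Main "HOL-Algebra.Congruence"
begin

section \<open>Pseudo-BCK algebras\<close>

text \<open>Algebras are records with an explicit carrier, so that an interval of an algebra is an algebra
  of the same kind. Every notion below depends only on the values of the operations, the order and
  the measures on the carrier.\<close>

record 'a pbck = "'a partial_object" +
  le   :: "'a \<Rightarrow> 'a \<Rightarrow> bool" (infix "\<sqsubseteq>\<index>" 50)
  imp1 :: "'a \<Rightarrow> 'a \<Rightarrow> 'a" (infixr "\<^bold>\<rightarrow>\<index>" 65)
  imp2 :: "'a \<Rightarrow> 'a \<Rightarrow> 'a" (infixr "\<^bold>\<leadsto>\<index>" 65)
  one  :: 'a ("\<one>\<index>")

locale pseudo_bck =
  fixes A :: "('a, 'b) pbck_scheme" (structure)
  assumes imp1_closed [intro, simp]: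
      "\<lbrakk>x \<in> carrier A; y \<in> carrier A\<rbrakk> \<Longrightarrow> x \<^bold>\<rightarrow> y \<in> carrier A"
    and imp2_closed [intro, simp]:
      "\<lbrakk>x \<in> carrier A; y \<in> carrier A\<rbrakk> \<Longrightarrow> x \<^bold>\<leadsto> y \<in> carrier A"
    and one_closed [intro, simp]: "\<one> \<in> carrier A"
    and imp1_trans: "\<lbrakk>x \<in> carrier A; y \<in> carrier A; z \<in> carrier A\<rbrakk>
      \<Longrightarrow> (x \<^bold>\<rightarrow> y) \<sqsubseteq> ((y \<^bold>\<rightarrow> z) \<^bold>\<leadsto> (x \<^bold>\<rightarrow> z))"
    and imp2_trans: "\<lbrakk>x \<in> carrier A; y \<in> carrier A; z \<in> carrier A\<rbrakk>
      \<Longrightarrow> (x \<^bold>\<leadsto> y) \<sqsubseteq> ((y \<^bold>\<leadsto> z) \<^bold>\<rightarrow> (x \<^bold>\<leadsto> z))"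
    and le_imp1_imp2: "\<lbrakk>x \<in> carrier A; y \<in> carrier A\<rbrakk> \<Longrightarrow> x \<sqsubseteq> ((x \<^bold>\<rightarrow> y) \<^bold>\<leadsto> y)"
    and le_imp2_imp1: "\<lbrakk>x \<in> carrier A; y \<in> carrier A\<rbrakk> \<Longrightarrow> x \<sqsubseteq> ((x \<^bold>\<leadsto> y) \<^bold>\<rightarrow> y)"
    and le_refl: "x \<in> carrier A \<Longrightarrow> x \<sqsubseteq> x"
    and le_one: "x \<in> carrier A \<Longrightarrow> x \<sqsubseteq> \<one>"
    and le_antisym: "\<lbrakk>x \<in> carrier A; y \<in> carrier A; x \<sqsubseteq> y; y \<sqsubseteq> x\<rbrakk> \<Longrightarrow> x = y"
    and le_iff_imp1: "\<lbrakk>x \<in> carrier A; y \<in> carrier A\<rbrakk> \<Longrightarrow> x \<sqsubseteq> y \<longleftrightarrow> x \<^bold>\<rightarrow> y = \<one>"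
    and le_iff_imp2: "\<lbrakk>x \<in> carrier A; y \<in> carrier A\<rbrakk> \<Longrightarrow> x \<sqsubseteq> y \<longleftrightarrow> x \<^bold>\<leadsto> y = \<one>"

definition downwards_directed :: "('a, 'b) pbck_scheme \<Rightarrow> bool" where
  "downwards_directed A \<longleftrightarrow>
     (\<forall>x\<in>carrier A. \<forall>y\<in>carrier A. \<exists>z\<in>carrier A. z \<sqsubseteq>\<^bsub>A\<^esub> x \<and> z \<sqsubseteq>\<^bsub>A\<^esub> y)"

primrec imp1_pow :: "('a, 'b) pbck_scheme \<Rightarrow> nat \<Rightarrow> 'a \<Rightarrow> 'a \<Rightarrow> 'a" where
  "imp1_pow A 0 x y = y"
| "imp1_pow A (Suc n) x y = x \<^bold>\<rightarrow>\<^bsub>A\<^esub> imp1_pow A n x y"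

definition strong_unit :: "('a, 'b) pbck_scheme \<Rightarrow> 'a \<Rightarrow> bool" where
  "strong_unit A u \<longleftrightarrow>
     u \<in> carrier A \<and> (\<forall>a\<in>carrier A. \<exists>n\<ge>1. imp1_pow A n u a = \<one>\<^bsub>A\<^esub>)"

locale unital_pseudo_bck = pseudo_bck +
  fixes u
  assumes strong_unit: "strong_unit A u"

definition upper_interval :: "('a, 'b) pbck_scheme \<Rightarrow> 'a \<Rightarrow> ('a, 'b) pbck_scheme" where
  "upper_interval A u =
     A\<lparr>carrier := {x \<in> carrier A. u \<sqsubseteq>\<^bsub>A\<^esub> x \<and> x \<sqsubseteq>\<^bsub>A\<^esub> \<one>\<^bsub>A\<^esub>}\<rparr>"

locale bounded_pseudo_bck = pseudo_bck +
  fixes u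
  assumes bot_closed: "u \<in> carrier A"
    and bot_le: "x \<in> carrier A \<Longrightarrow> u \<sqsubseteq> x"


section \<open>Measures\<close>

definition measure_on :: "('a, 'b) pbck_scheme \<Rightarrow> ('a \<Rightarrow> real) \<Rightarrow> bool" where
  "measure_on A m \<longleftrightarrow>
     (\<forall>x\<in>carrier A. 0 \<le> m x) \<and>
     (\<forall>x\<in>carrier A. \<forall>y\<in>carrier A. y \<sqsubseteq>\<^bsub>A\<^esub> x \<longrightarrow>
        m (x \<^bold>\<rightarrow>\<^bsub>A\<^esub> y) = m y - m x \<and> m (x \<^bold>\<leadsto>\<^bsub>A\<^esub> y) = m y - m x)"

definition measure_morphism :: "('a, 'b) pbck_scheme \<Rightarrow> ('a \<Rightarrow> real) \<Rightarrow> bool" where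
  "measure_morphism A m \<longleftrightarrow>
     (\<forall>x\<in>carrier A. 0 \<le> m x) \<and>
     (\<forall>x\<in>carrier A. \<forall>y\<in>carrier A.
        m (x \<^bold>\<rightarrow>\<^bsub>A\<^esub> y) = max 0 (m y - m x) \<and> m (x \<^bold>\<leadsto>\<^bsub>A\<^esub> y) = max 0 (m y - m x))"

text \<open>The point \<open>u\<close> is the strong unit in the unital case and the least element in the bounded
  case; the two definitions of a state-measure have the same form.\<close>

definition state_measure :: "('a, 'b) pbck_scheme \<Rightarrow> 'a \<Rightarrow> ('a \<Rightarrow> real) \<Rightarrow> bool" where
  "state_measure A u m \<longleftrightarrow> measure_on A m \<and> m u = 1"

definition state_measure_morphism :: "('a, 'b) pbck_scheme \<Rightarrow> 'a \<Rightarrow> ('a \<Rightarrow> real) \<Rightarrow> bool" where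
  "state_measure_morphism A u m \<longleftrightarrow> state_measure A u m \<and> measure_morphism A m"

text \<open>Since measures are total functions in HOL, equality of measures is equality on the
  carrier.\<close>

definition extremal_state_measure :: "('a, 'b) pbck_scheme \<Rightarrow> 'a \<Rightarrow> ('a \<Rightarrow> real) \<Rightarrow> bool" where
  "extremal_state_measure A u m \<longleftrightarrow>
     state_measure A u m \<and>
     (\<forall>m1 m2 t. state_measure A u m1 \<longrightarrow> state_measure A u m2 \<longrightarrow> 0 < t \<longrightarrow> t < 1 \<longrightarrow>
        (\<forall>x\<in>carrier A. m x = t * m1 x + (1 - t) * m2 x) \<longrightarrow>
        (\<forall>x\<in>carrier A. m x = m1 x \<and> m x = m2 x))"

definition Ker0 :: "('a, 'b) pbck_scheme \<Rightarrow> ('a \<Rightarrow> real) \<Rightarrow> 'a set" where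
  "Ker0 A m = {x \<in> carrier A. m x = 0}"


section \<open>Filters\<close>

definition pbck_filter :: "('a, 'b) pbck_scheme \<Rightarrow> 'a set \<Rightarrow> bool" where
  "pbck_filter A F \<longleftrightarrow>
     F \<subseteq> carrier A \<and> \<one>\<^bsub>A\<^esub> \<in> F \<and>
     (\<forall>a\<in>carrier A. \<forall>b\<in>carrier A. a \<in> F \<longrightarrow> a \<^bold>\<rightarrow>\<^bsub>A\<^esub> b \<in> F \<longrightarrow> b \<in> F)"

definition maximal_filter :: "('a, 'b) pbck_scheme \<Rightarrow> 'a set \<Rightarrow> bool" where
  "maximal_filter A F \<longleftrightarrow>
     pbck_filter A F \<and> F \<noteq> carrier A \<and>
     \<not> (\<exists>G. pbck_filter A G \<and> G \<noteq> carrier A \<and> F \<subset> G)"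


section \<open>Upper intervals are bounded pseudo-BCK algebras\<close>

context pseudo_bck
begin

lemma one_le_iff: "x \<in> carrier A \<Longrightarrow> \<one> \<sqsubseteq> x \<longleftrightarrow> x = \<one>"
  using le_antisym le_one le_refl one_closed by blast

lemma one_imp1: "y \<in> carrier A \<Longrightarrow> \<one> \<^bold>\<rightarrow> y = y"
  by (metis imp1_closed le_antisym le_iff_imp2 le_imp1_imp2 le_imp2_imp1 le_refl one_closed one_le_iff imp2_closed)

lemma one_imp2: "y \<in> carrier A \<Longrightarrow> \<one> \<^bold>\<leadsto> y = y"
  by (metis imp2_closed le_antisym le_iff_imp1 le_imp2_imp1 le_imp1_imp2 le_refl one_closed one_le_iff imp1_closed)

lemma le_imp1: "\<lbrakk>x \<in> carrier A; y \<in> carrier A\<rbrakk> \<Longrightarrow> y \<sqsubseteq> (x \<^bold>\<rightarrow> y)"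
  using imp1_trans[of x "\<one>" y] one_imp1[of y] le_one[of x] le_iff_imp1[of x "\<one>"]
    one_le_iff[of "y \<^bold>\<leadsto> (x \<^bold>\<rightarrow> y)"] le_iff_imp2[of y "x \<^bold>\<rightarrow> y"] by simp

lemma le_imp2: "\<lbrakk>x \<in> carrier A; y \<in> carrier A\<rbrakk> \<Longrightarrow> y \<sqsubseteq> (x \<^bold>\<leadsto> y)"
  using imp2_trans[of x "\<one>" y] one_imp2[of y] le_one[of x] le_iff_imp2[of x "\<one>"]
    one_le_iff[of "y \<^bold>\<rightarrow> (x \<^bold>\<leadsto> y)"] le_iff_imp1[of y "x \<^bold>\<leadsto> y"] by simp

lemma le_trans:
  assumes "x \<in> carrier A" "y \<in> carrier A" "z \<in> carrier A" "x \<sqsubseteq> y" "y \<sqsubseteq> z"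
  shows "x \<sqsubseteq> z"
  using imp1_trans[of x y z] le_iff_imp1[of x y] le_iff_imp1[of y z] le_iff_imp1[of x z]
    one_imp2[of "x \<^bold>\<rightarrow> z"] one_le_iff[of "x \<^bold>\<rightarrow> z"] assms by simp

lemma bounded_pseudo_bck_upper_interval:
  assumes u: "u \<in> carrier A"
  shows "bounded_pseudo_bck (upper_interval A u) u"
proof -
  have c1: "u \<sqsubseteq> (x \<^bold>\<rightarrow> y)" if "x \<in> carrier A" "y \<in> carrier A" "u \<sqsubseteq> y" for x y
    using that le_trans[of u y "x \<^bold>\<rightarrow> y"] le_imp1 u by simp
  have c2: "u \<sqsubseteq> (x \<^bold>\<leadsto> y)" if "x \<in> carrier A" "y \<in> carrier A" "u \<sqsubseteq> y" for x y
    using that le_trans[of u y "x \<^bold>\<leadsto> y"] le_imp2 u by simp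
  show ?thesis
    by unfold_locales
      (auto simp: upper_interval_def u le_one le_refl c1 c2 imp1_trans imp2_trans
        le_imp1_imp2 le_imp2_imp1 le_antisym simp flip: le_iff_imp1 le_iff_imp2)
qed

end

end

theory Submission
  imports Defs
begin

text \<open>Modulo \<open>Ker0 A m\<close> the algebra is a join-semilattice in which \<open>m (x \<^bold>\<rightarrow> y) = m y - m (x \<squnion> y)\<close>, and
  common lower bounds make it prelinear: \<open>p = x \<^bold>\<rightarrow> y\<close> lies in the polar of \<open>q = y \<^bold>\<rightarrow> x\<close>, that is, in
  the filter of all \<open>c\<close> with \<open>m (c \<^bold>\<rightarrow> q) = m q\<close>. The measure \<open>m\<close> is a morphism iff one of \<open>p\<close>, \<open>q\<close> is
  always in the kernel. If the kernel is maximal, then the polar of \<open>q\<close> is the kernel or the whole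
  algebra, and one of \<open>p\<close>, \<open>q\<close> is in the kernel. If \<open>m\<close> is extremal, then the same follows from the
  fact that, for every filter \<open>F\<close>, both \<open>d = (\<lambda>x. INF c\<in>F. m (c \<^bold>\<rightarrow> x))\<close> and \<open>m - d\<close> are measures.
  Conversely, a state-measure-morphism is, by an Archimedean argument, the only state-measure that
  vanishes on its kernel, which gives extremality. The interval \<open>[u, 1]\<close> is itself a unital
  downwards-directed algebra, so it remains to compare maximality of the two kernels.\<close>

section \<open>Arithmetic of pseudo-BCK algebras\<close>

context pseudo_bck
begin

lemma imp1_antimono:
  assumes "x \<in> carrier A" "y \<in> carrier A" "z \<in> carrier A" "x \<sqsubseteq> y"
  shows "(y \<^bold>\<rightarrow> z) \<sqsubseteq> (x \<^bold>\<rightarrow> z)"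
proof -
  have "\<one> \<sqsubseteq> ((y \<^bold>\<rightarrow> z) \<^bold>\<leadsto> (x \<^bold>\<rightarrow> z))"
    using imp1_trans[of x y z] assms le_iff_imp1[of x y] by simp
  then show ?thesis
    using assms one_le_iff le_iff_imp2 by simp
qed

lemma imp2_antimono:
  assumes "x \<in> carrier A" "y \<in> carrier A" "z \<in> carrier A" "x \<sqsubseteq> y"
  shows "(y \<^bold>\<leadsto> z) \<sqsubseteq> (x \<^bold>\<leadsto> z)"
proof -
  have "\<one> \<sqsubseteq> ((y \<^bold>\<leadsto> z) \<^bold>\<rightarrow> (x \<^bold>\<leadsto> z))"
    using imp2_trans[of x y z] assms le_iff_imp2[of x y] by simp
  then show ?thesis
    using assms one_le_iff le_iff_imp1 by simp
qed

text \<open>An antitone Galois connection between the two arrows; it stands in for residuation, as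
  there is no product.\<close>

lemma le_imp1_iff_le_imp2:
  assumes "x \<in> carrier A" "y \<in> carrier A" "z \<in> carrier A"
  shows "x \<sqsubseteq> (y \<^bold>\<rightarrow> z) \<longleftrightarrow> y \<sqsubseteq> (x \<^bold>\<leadsto> z)"
proof
  assume "x \<sqsubseteq> (y \<^bold>\<rightarrow> z)"
  then have "((y \<^bold>\<rightarrow> z) \<^bold>\<leadsto> z) \<sqsubseteq> (x \<^bold>\<leadsto> z)" using assms imp2_antimono by simp
  then show "y \<sqsubseteq> (x \<^bold>\<leadsto> z)"
    using assms le_imp1_imp2[of y z] le_trans[of y "(y \<^bold>\<rightarrow> z) \<^bold>\<leadsto> z" "x \<^bold>\<leadsto> z"] by simp
next
  assume "y \<sqsubseteq> (x \<^bold>\<leadsto> z)"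
  then have "((x \<^bold>\<leadsto> z) \<^bold>\<rightarrow> z) \<sqsubseteq> (y \<^bold>\<rightarrow> z)" using assms imp1_antimono by simp
  then show "x \<sqsubseteq> (y \<^bold>\<rightarrow> z)"
    using assms le_imp2_imp1[of x z] le_trans[of x "(x \<^bold>\<leadsto> z) \<^bold>\<rightarrow> z" "y \<^bold>\<rightarrow> z"] by simp
qed

lemma imp1_le_imp1_imp1:
  assumes "x \<in> carrier A" "y \<in> carrier A" "z \<in> carrier A"
  shows "(y \<^bold>\<rightarrow> z) \<sqsubseteq> ((x \<^bold>\<rightarrow> y) \<^bold>\<rightarrow> (x \<^bold>\<rightarrow> z))"
  using assms imp1_trans[of x y z] le_imp1_iff_le_imp2 by simp

lemma imp2_le_imp2_imp2:
  assumes "x \<in> carrier A" "y \<in> carrier A" "z \<in> carrier A"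
  shows "(y \<^bold>\<leadsto> z) \<sqsubseteq> ((x \<^bold>\<leadsto> y) \<^bold>\<leadsto> (x \<^bold>\<leadsto> z))"
  using assms imp2_trans[of x y z] le_imp1_iff_le_imp2 by simp

lemma imp1_mono:
  assumes "x \<in> carrier A" "y \<in> carrier A" "z \<in> carrier A" "y \<sqsubseteq> z"
  shows "(x \<^bold>\<rightarrow> y) \<sqsubseteq> (x \<^bold>\<rightarrow> z)"
  using imp1_le_imp1_imp1[of x y z] assms le_iff_imp1 one_le_iff by simp

lemma imp2_mono:
  assumes "x \<in> carrier A" "y \<in> carrier A" "z \<in> carrier A" "y \<sqsubseteq> z"
  shows "(x \<^bold>\<leadsto> y) \<sqsubseteq> (x \<^bold>\<leadsto> z)"
  using imp2_le_imp2_imp2[of x y z] assms le_iff_imp2 one_le_iff by simp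

lemma imp1_imp2_exchange:
  assumes "x \<in> carrier A" "y \<in> carrier A" "z \<in> carrier A"
  shows "x \<^bold>\<rightarrow> (y \<^bold>\<leadsto> z) = y \<^bold>\<leadsto> (x \<^bold>\<rightarrow> z)"
proof (rule le_antisym)
  have "y \<sqsubseteq> ((x \<^bold>\<rightarrow> (y \<^bold>\<leadsto> z)) \<^bold>\<rightarrow> (x \<^bold>\<rightarrow> z))"
    using assms le_imp2_imp1[of y z] imp1_le_imp1_imp1[of x "y \<^bold>\<leadsto> z" z]
      le_trans[of y "(y \<^bold>\<leadsto> z) \<^bold>\<rightarrow> z" "(x \<^bold>\<rightarrow> (y \<^bold>\<leadsto> z)) \<^bold>\<rightarrow> (x \<^bold>\<rightarrow> z)"] by simp
  then show "(x \<^bold>\<rightarrow> (y \<^bold>\<leadsto> z)) \<sqsubseteq> (y \<^bold>\<leadsto> (x \<^bold>\<rightarrow> z))"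
    using assms le_imp1_iff_le_imp2 by simp
  have "x \<sqsubseteq> ((y \<^bold>\<leadsto> (x \<^bold>\<rightarrow> z)) \<^bold>\<leadsto> (y \<^bold>\<leadsto> z))"
    using assms le_imp1_imp2[of x z] imp2_le_imp2_imp2[of y "x \<^bold>\<rightarrow> z" z]
      le_trans[of x "(x \<^bold>\<rightarrow> z) \<^bold>\<leadsto> z" "(y \<^bold>\<leadsto> (x \<^bold>\<rightarrow> z)) \<^bold>\<leadsto> (y \<^bold>\<leadsto> z)"] by simp
  then show "(y \<^bold>\<leadsto> (x \<^bold>\<rightarrow> z)) \<sqsubseteq> (x \<^bold>\<rightarrow> (y \<^bold>\<leadsto> z))"
    using assms le_imp1_iff_le_imp2 by simp
qed (use assms in auto)

lemma imp1_pow_closed [simp]: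
  "\<lbrakk>x \<in> carrier A; y \<in> carrier A\<rbrakk> \<Longrightarrow> imp1_pow A n x y \<in> carrier A"
  by (induction n) auto

lemma filter_mp:
  "\<lbrakk>pbck_filter A F; a \<in> F; a \<^bold>\<rightarrow> b \<in> F; b \<in> carrier A\<rbrakk> \<Longrightarrow> b \<in> F"
  unfolding pbck_filter_def by blast

lemma filter_up:
  assumes "pbck_filter A F" "a \<in> F" "a \<sqsubseteq> b" "b \<in> carrier A"
  shows "b \<in> F"
proof -
  have "a \<in> carrier A" "\<one> \<in> F" using assms unfolding pbck_filter_def by blast+
  then show ?thesis using filter_mp[of F a b] le_iff_imp1[of a b] assms by simp
qed

lemma filter_imp1_pow:
  assumes "pbck_filter A F" "a \<in> F" "x \<in> carrier A" "imp1_pow A n a x \<in> F"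
  shows "x \<in> F"
proof -
  have "a \<in> carrier A" using assms unfolding pbck_filter_def by blast
  with assms show ?thesis
  proof (induction n)
    case (Suc n)
    then show ?case using filter_mp[of F a "imp1_pow A n a x"] by simp
  qed simp
qed

end

lemma (in unital_pseudo_bck) filter_unit_eq_carrier:
  assumes "pbck_filter A F" "u \<in> F"
  shows "F = carrier A"
proof -
  have "x \<in> F" if "x \<in> carrier A" for x
    using strong_unit that filter_imp1_pow[OF assms that] assms(1)
    unfolding strong_unit_def pbck_filter_def by metis
  then show ?thesis using assms unfolding pbck_filter_def by blast
qed


section \<open>Measures and their kernels\<close>

locale pbck_measure = pseudo_bck +
  fixes m :: "'a \<Rightarrow> real"
  assumes measure: "measure_on A m"
begin

lemma nonneg: "x \<in> carrier A \<Longrightarrow> 0 \<le> m x"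
  using measure unfolding measure_on_def by blast

lemma imp1_eq: "\<lbrakk>x \<in> carrier A; y \<in> carrier A; y \<sqsubseteq> x\<rbrakk> \<Longrightarrow> m (x \<^bold>\<rightarrow> y) = m y - m x"
  using measure unfolding measure_on_def by blast

lemma imp2_eq: "\<lbrakk>x \<in> carrier A; y \<in> carrier A; y \<sqsubseteq> x\<rbrakk> \<Longrightarrow> m (x \<^bold>\<leadsto> y) = m y - m x"
  using measure unfolding measure_on_def by blast

lemma m_one [simp]: "m \<one> = 0"
  using imp1_eq[of \<one> \<one>] one_imp1[of \<one>] le_refl[of \<one>] by simp

lemma antimono: "\<lbrakk>x \<in> carrier A; y \<in> carrier A; x \<sqsubseteq> y\<rbrakk> \<Longrightarrow> m y \<le> m x"
  using imp1_eq[of y x] nonneg[of "y \<^bold>\<rightarrow> x"] by simp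

section \<open>Joins and their measure\<close>

lemma join1_eq:
  "\<lbrakk>x \<in> carrier A; y \<in> carrier A\<rbrakk> \<Longrightarrow> m ((x \<^bold>\<rightarrow> y) \<^bold>\<leadsto> y) = m y - m (x \<^bold>\<rightarrow> y)"
  using imp2_eq[of "x \<^bold>\<rightarrow> y" y] le_imp1 by simp

lemma join2_eq:
  "\<lbrakk>x \<in> carrier A; y \<in> carrier A\<rbrakk> \<Longrightarrow> m ((x \<^bold>\<leadsto> y) \<^bold>\<rightarrow> y) = m y - m (x \<^bold>\<leadsto> y)"
  using imp1_eq[of "x \<^bold>\<leadsto> y" y] le_imp2 by simp

lemma upper_bound_le1:
  assumes "x \<in> carrier A" "y \<in> carrier A" "c \<in> carrier A" "x \<sqsubseteq> c" "y \<sqsubseteq> c"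
  shows "m c \<le> m y - m (x \<^bold>\<rightarrow> y)"
  using assms imp1_eq[of c y] antimono[of "c \<^bold>\<rightarrow> y" "x \<^bold>\<rightarrow> y"] imp1_antimono[of x c y] by simp

lemma upper_bound_le2:
  assumes "x \<in> carrier A" "y \<in> carrier A" "c \<in> carrier A" "x \<sqsubseteq> c" "y \<sqsubseteq> c"
  shows "m c \<le> m y - m (x \<^bold>\<leadsto> y)"
  using assms imp2_eq[of c y] antimono[of "c \<^bold>\<leadsto> y" "x \<^bold>\<leadsto> y"] imp2_antimono[of x c y] by simp

text \<open>Both \<open>(x \<^bold>\<rightarrow> y) \<^bold>\<leadsto> y\<close> and \<open>(x \<^bold>\<leadsto> y) \<^bold>\<rightarrow> y\<close> are upper bounds of \<open>x\<close> and \<open>y\<close> whose measure is the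
  greatest among all upper bounds.\<close>

lemma imp1_imp2_same:
  assumes "x \<in> carrier A" "y \<in> carrier A"
  shows "m (x \<^bold>\<leadsto> y) = m (x \<^bold>\<rightarrow> y)"
proof (rule antisym)
  show "m (x \<^bold>\<leadsto> y) \<le> m (x \<^bold>\<rightarrow> y)"
    using assms upper_bound_le2[of x y "(x \<^bold>\<rightarrow> y) \<^bold>\<leadsto> y"] join1_eq[of x y]
      le_imp1_imp2[of x y] le_imp2[of "x \<^bold>\<rightarrow> y" y] by simp
  show "m (x \<^bold>\<rightarrow> y) \<le> m (x \<^bold>\<leadsto> y)"
    using assms upper_bound_le1[of x y "(x \<^bold>\<leadsto> y) \<^bold>\<rightarrow> y"] join2_eq[of x y]
      le_imp2_imp1[of x y] le_imp1[of "x \<^bold>\<leadsto> y" y] by simp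
qed

text \<open>Each side is the measure of a join of \<open>x\<close> and \<open>y\<close>, and
  \<open>upper_bound_le1\<close> bounds the measure of either join by that of the other.\<close>

lemma join_commute:
  assumes "x \<in> carrier A" "y \<in> carrier A"
  shows "m y - m (x \<^bold>\<rightarrow> y) = m x - m (y \<^bold>\<rightarrow> x)"
  using assms upper_bound_le1[of y x "(x \<^bold>\<rightarrow> y) \<^bold>\<leadsto> y"] upper_bound_le1[of x y "(y \<^bold>\<rightarrow> x) \<^bold>\<leadsto> x"]
    join1_eq[of x y] join1_eq[of y x] le_imp1_imp2[of x y] le_imp1_imp2[of y x]
    le_imp2[of "x \<^bold>\<rightarrow> y" y] le_imp2[of "y \<^bold>\<rightarrow> x" x] by simp

lemma diff_le_imp1:
  assumes "x \<in> carrier A" "y \<in> carrier A"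
  shows "m y - m x \<le> m (x \<^bold>\<rightarrow> y)"
  using assms antimono[of x "(x \<^bold>\<rightarrow> y) \<^bold>\<leadsto> y"] join1_eq[of x y] le_imp1_imp2[of x y] by simp

lemma diff_le_imp1_pow:
  assumes "x \<in> carrier A" "y \<in> carrier A"
  shows "m y - real n * m x \<le> m (imp1_pow A n x y)"
proof (induction n)
  case (Suc n)
  then show ?case
    using assms diff_le_imp1[of x "imp1_pow A n x y"] by (simp add: algebra_simps)
qed simp

lemma filter_Ker0: "pbck_filter A (Ker0 A m)"
  unfolding pbck_filter_def Ker0_def
proof (intro conjI ballI impI)
  fix a b assume "a \<in> carrier A" "b \<in> carrier A" "a \<in> {x \<in> carrier A. m x = 0}"
    "a \<^bold>\<rightarrow> b \<in> {x \<in> carrier A. m x = 0}"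
  then show "b \<in> {x \<in> carrier A. m x = 0}"
    using diff_le_imp1[of a b] nonneg[of b] by simp
qed auto

text \<open>The order of the quotient by \<open>Ker0 A m\<close>, in which \<open>(x \<^bold>\<rightarrow> y) \<^bold>\<leadsto> y\<close> is the join of \<open>x\<close> and \<open>y\<close>.\<close>

definition mle :: "'a \<Rightarrow> 'a \<Rightarrow> bool" (infix "\<preceq>" 50) where
  "x \<preceq> y \<longleftrightarrow> x \<in> carrier A \<and> y \<in> carrier A \<and> m (x \<^bold>\<rightarrow> y) = 0"

lemma mle_closed: "x \<preceq> y \<Longrightarrow> x \<in> carrier A" "x \<preceq> y \<Longrightarrow> y \<in> carrier A"
  unfolding mle_def by auto

lemma mle_of_le: "\<lbrakk>x \<in> carrier A; y \<in> carrier A; x \<sqsubseteq> y\<rbrakk> \<Longrightarrow> x \<preceq> y"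
  unfolding mle_def using le_iff_imp1 by simp

lemma mle_antimono: "x \<preceq> y \<Longrightarrow> m y \<le> m x"
  unfolding mle_def using diff_le_imp1[of x y] by simp

text \<open>Comparable elements of equal measure are identified modulo the kernel; this is how
  reverse inequalities arise.\<close>

lemma mle_of_ge:
  "\<lbrakk>x \<in> carrier A; y \<in> carrier A; y \<sqsubseteq> x; m y \<le> m x\<rbrakk> \<Longrightarrow> x \<preceq> y"
  unfolding mle_def using imp1_eq[of x y] antimono[of y x] by simp

lemma imp1_mle_mono:
  assumes "x \<preceq> y" "w \<in> carrier A"
  shows "(w \<^bold>\<rightarrow> x) \<preceq> (w \<^bold>\<rightarrow> y)"
  using assms antimono[OF _ _ imp1_le_imp1_imp1[of w x y]] nonneg[of "(w \<^bold>\<rightarrow> x) \<^bold>\<rightarrow> (w \<^bold>\<rightarrow> y)"]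
  unfolding mle_def by simp

text \<open>The axiom \<open>imp1_trans\<close> mixes the two arrows, but by
  \<open>imp1_imp2_same\<close> the kernel does not distinguish them.\<close>

lemma imp1_mle_antimono:
  assumes "x \<preceq> y" "w \<in> carrier A"
  shows "(y \<^bold>\<rightarrow> w) \<preceq> (x \<^bold>\<rightarrow> w)"
  using assms antimono[OF _ _ imp1_trans[of x y w]] nonneg[of "(y \<^bold>\<rightarrow> w) \<^bold>\<leadsto> (x \<^bold>\<rightarrow> w)"]
    imp1_imp2_same[of "y \<^bold>\<rightarrow> w" "x \<^bold>\<rightarrow> w"]
  unfolding mle_def by simp

lemma imp2_mle_antimono:
  assumes "x \<preceq> y" "w \<in> carrier A"
  shows "(y \<^bold>\<leadsto> w) \<preceq> (x \<^bold>\<leadsto> w)"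
  using assms antimono[OF _ _ imp2_trans[of x y w]] nonneg[of "(y \<^bold>\<leadsto> w) \<^bold>\<rightarrow> (x \<^bold>\<leadsto> w)"]
    imp1_imp2_same[of x y]
  unfolding mle_def by simp

lemma mle_trans [trans]:
  assumes "x \<preceq> y" "y \<preceq> z"
  shows "x \<preceq> z"
  using mle_antimono[OF imp1_mle_mono[OF assms(2), of x]] assms nonneg[of "x \<^bold>\<rightarrow> z"]
  unfolding mle_def by simp

text \<open>Enlarging \<open>x\<close> to \<open>z\<close> enlarges the nested arrow; with
  \<open>y\<close> below \<open>z\<close> it then has the measure of \<open>z\<close> and collapses
  to \<open>z\<close>.\<close>

lemma join1_mle:
  assumes "x \<preceq> z" "y \<preceq> z"
  shows "((x \<^bold>\<rightarrow> y) \<^bold>\<leadsto> y) \<preceq> z"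
proof -
  note cl = mle_closed[OF assms(1)] mle_closed[OF assms(2)]
  have "((x \<^bold>\<rightarrow> y) \<^bold>\<leadsto> y) \<preceq> ((z \<^bold>\<rightarrow> y) \<^bold>\<leadsto> y)"
    using imp2_mle_antimono[OF imp1_mle_antimono[OF assms(1)]] cl by simp
  also have "((z \<^bold>\<rightarrow> y) \<^bold>\<leadsto> y) \<preceq> z"
    using cl assms(2) join1_eq[of z y] join_commute[of y z]
    by (intro mle_of_ge) (auto simp: mle_def le_imp1_imp2)
  finally show ?thesis .
qed

lemma join2_mle:
  assumes "y \<preceq> x"
  shows "((x \<^bold>\<leadsto> y) \<^bold>\<rightarrow> y) \<preceq> x"
  using mle_closed[OF assms] assms join2_eq[of x y] join_commute[of x y] imp1_imp2_same[of x y]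
  by (intro mle_of_ge) (auto simp: mle_def le_imp2_imp1)

section \<open>Polars and prelinearity\<close>

text \<open>By \<open>join1_eq\<close> the condition says that the join of \<open>c\<close> and
  \<open>q\<close> has measure 0: the two are orthogonal modulo the kernel.\<close>

definition polar :: "'a \<Rightarrow> 'a set" where
  "polar q = {c \<in> carrier A. m (c \<^bold>\<rightarrow> q) = m q}"

text \<open>For \<open>c\<close> in the polar, \<open>c \<rightarrow> q\<close> and \<open>q\<close>
  agree modulo the kernel, so \<open>(c \<rightarrow> d) \<rightarrow> q\<close> can be compared
  with \<open>(c \<rightarrow> d) \<rightarrow> (c \<rightarrow> q)\<close>, which lies above
  \<open>d \<rightarrow> q\<close>.\<close>

lemma filter_polar:
  assumes q: "q \<in> carrier A"
  shows "pbck_filter A (polar q)"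
  unfolding pbck_filter_def
proof (intro conjI ballI impI)
  show "polar q \<subseteq> carrier A" unfolding polar_def by blast
  show "\<one> \<in> polar q" unfolding polar_def using q one_imp1 by simp
next
  fix c d assume cl: "c \<in> carrier A" "d \<in> carrier A" and c: "c \<in> polar q" and cd: "c \<^bold>\<rightarrow> d \<in> polar q"
  have "(c \<^bold>\<rightarrow> q) \<preceq> q"
    using c cl q by (intro mle_of_ge) (auto simp: polar_def le_imp1)
  then have "m ((c \<^bold>\<rightarrow> d) \<^bold>\<rightarrow> q) \<le> m ((c \<^bold>\<rightarrow> d) \<^bold>\<rightarrow> (c \<^bold>\<rightarrow> q))"
    using imp1_mle_mono mle_antimono cl by blast
  moreover have "m ((c \<^bold>\<rightarrow> d) \<^bold>\<rightarrow> (c \<^bold>\<rightarrow> q)) \<le> m (d \<^bold>\<rightarrow> q)"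
    using antimono imp1_le_imp1_imp1[of c d q] cl q by simp
  moreover have "m (d \<^bold>\<rightarrow> q) \<le> m q"
    using antimono le_imp1 cl q by simp
  ultimately show "d \<in> polar q"
    using cd cl unfolding polar_def by simp
qed

lemma Ker0_subset_polar:
  assumes "q \<in> carrier A"
  shows "Ker0 A m \<subseteq> polar q"
proof
  fix c assume "c \<in> Ker0 A m"
  then show "c \<in> polar q"
    using assms diff_le_imp1[of c q] antimono[of q "c \<^bold>\<rightarrow> q"] le_imp1[of c q]
    unfolding Ker0_def polar_def by simp
qed

lemma polar_self: "\<lbrakk>q \<in> carrier A; q \<in> polar q\<rbrakk> \<Longrightarrow> m q = 0"
  unfolding polar_def using le_iff_imp1[of q q] le_refl[of q] by simp

text \<open>With a lower bound \<open>z\<close>, the maps \<open>t \<mapsto> t \<^bold>\<rightarrow> z\<close> and \<open>t \<mapsto> t \<^bold>\<leadsto> z\<close> are mutually inverse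
  antitone bijections of \<open>[z, 1]\<close> modulo the kernel. They turn \<open>j \<^bold>\<rightarrow> y\<close> into \<open>y' \<^bold>\<leadsto> j'\<close>, so an upper bound
  \<open>r\<close> of \<open>j \<^bold>\<rightarrow> y\<close> and \<open>j \<^bold>\<rightarrow> x\<close> yields a lower bound \<open>r \<^bold>\<rightarrow> j'\<close> of \<open>x'\<close> and \<open>y'\<close>, which must be below
  \<open>j'\<close>.\<close>

lemma prelinear:
  assumes cl: "x \<in> carrier A" "y \<in> carrier A" "z \<in> carrier A" and z: "z \<sqsubseteq> x" "z \<sqsubseteq> y"
  shows "x \<^bold>\<rightarrow> y \<in> polar (y \<^bold>\<rightarrow> x)"
proof -
  define p where "p = x \<^bold>\<rightarrow> y"
  define q where "q = y \<^bold>\<rightarrow> x"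
  define j where "j = p \<^bold>\<leadsto> y"
  define r where "r = (p \<^bold>\<rightarrow> q) \<^bold>\<leadsto> q"
  define x' where "x' = x \<^bold>\<rightarrow> z"
  define y' where "y' = y \<^bold>\<rightarrow> z"
  define j' where "j' = j \<^bold>\<rightarrow> z"
  have cl': "p \<in> carrier A" "q \<in> carrier A" "j \<in> carrier A" "r \<in> carrier A"
    "x' \<in> carrier A" "y' \<in> carrier A" "j' \<in> carrier A"
    using cl by (auto simp: p_def q_def j_def r_def x'_def y'_def j'_def)
  note cl = cl cl'
  have xj: "x \<sqsubseteq> j" using cl le_imp1_imp2 by (simp add: j_def p_def)
  have yj: "y \<sqsubseteq> j" using cl le_imp2 by (simp add: j_def)
  have pr: "p \<sqsubseteq> r" using cl le_imp1_imp2 by (simp add: r_def)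
  have qr: "q \<sqsubseteq> r" using cl le_imp2 by (simp add: r_def)
  have low: "(r \<^bold>\<rightarrow> j') \<preceq> (w \<^bold>\<rightarrow> z) \<and> j' \<preceq> r"
    if w: "w \<in> carrier A" "v \<in> carrier A" "z \<sqsubseteq> w" "w \<sqsubseteq> j" "v \<sqsubseteq> j" "(v \<^bold>\<rightarrow> w) \<sqsubseteq> r" for v w
  proof -
    let ?w = "w \<^bold>\<rightarrow> z"
    have "?w \<^bold>\<leadsto> j' = j \<^bold>\<rightarrow> (?w \<^bold>\<leadsto> z)"
      using imp1_imp2_exchange cl w by (simp add: j'_def)
    moreover have "(?w \<^bold>\<leadsto> z) \<preceq> w"
      using join1_mle[of w w z] w cl mle_of_le le_refl by blast
    ultimately have "(?w \<^bold>\<leadsto> j') \<preceq> (j \<^bold>\<rightarrow> w)"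
      using imp1_mle_mono cl by simp
    also have "(j \<^bold>\<rightarrow> w) \<preceq> (v \<^bold>\<rightarrow> w)"
      using mle_of_le imp1_antimono w cl by simp
    also have "(v \<^bold>\<rightarrow> w) \<preceq> r"
      using mle_of_le w cl by simp
    finally have wr: "(?w \<^bold>\<leadsto> j') \<preceq> r" .
    have "(r \<^bold>\<rightarrow> j') \<preceq> ((?w \<^bold>\<leadsto> j') \<^bold>\<rightarrow> j')"
      using imp1_mle_antimono[OF wr] cl by simp
    also have "((?w \<^bold>\<leadsto> j') \<^bold>\<rightarrow> j') \<preceq> ?w"
      using join2_mle mle_of_le imp1_antimono[of w j z] w cl by (simp add: j'_def)
    finally have "(r \<^bold>\<rightarrow> j') \<preceq> ?w" .
    moreover have "j' \<preceq> (?w \<^bold>\<leadsto> j')"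
      using mle_of_le le_imp2 cl w by simp
    ultimately show ?thesis using mle_trans wr by blast
  qed
  have ly: "(r \<^bold>\<rightarrow> j') \<preceq> y'" and j'r: "j' \<preceq> r"
    using low[of y x] cl z xj yj pr by (auto simp: y'_def p_def)
  have lx: "(r \<^bold>\<rightarrow> j') \<preceq> x'"
    using low[of x y] cl z xj yj qr by (auto simp: x'_def q_def)
  \<comment> \<open>Dualising back turns the lower bound \<open>r \<rightarrow> j'\<close> of
    \<open>x'\<close> and \<open>y'\<close> into an upper bound \<open>k\<close> of \<open>x\<close>
    and \<open>y\<close>, which must dominate their join \<open>j\<close>.\<close>
  define k where "k = (r \<^bold>\<rightarrow> j') \<^bold>\<leadsto> z"
  have k: "k \<in> carrier A" using cl by (simp add: k_def)
  have "x \<preceq> (x' \<^bold>\<leadsto> z)" using mle_of_le le_imp1_imp2 cl by (simp add: x'_def)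
  also have "(x' \<^bold>\<leadsto> z) \<preceq> k" unfolding k_def using imp2_mle_antimono[OF lx] cl by simp
  finally have xk: "x \<preceq> k" .
  have "y \<preceq> (y' \<^bold>\<leadsto> z)" using mle_of_le le_imp1_imp2 cl by (simp add: y'_def)
  also have "(y' \<^bold>\<leadsto> z) \<preceq> k" unfolding k_def using imp2_mle_antimono[OF ly] cl by simp
  finally have yk: "y \<preceq> k" .
  have "j \<preceq> k" unfolding j_def p_def using join1_mle[OF xk yk] .
  then have "(k \<^bold>\<rightarrow> z) \<preceq> j'" unfolding j'_def using imp1_mle_antimono cl by simp
  moreover have "(r \<^bold>\<rightarrow> j') \<preceq> (k \<^bold>\<rightarrow> z)"
    unfolding k_def using mle_of_le le_imp2_imp1 cl by simp
  ultimately have "m j' \<le> m (r \<^bold>\<rightarrow> j')"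
    using mle_trans mle_antimono by blast
  \<comment> \<open>Since \<open>j' \<preceq> r\<close>, the join of the two is \<open>r\<close>,
    and its measure is also \<open>m j' - m (r \<rightarrow> j')\<close>.\<close>
  then have "m r - m (j' \<^bold>\<rightarrow> r) \<le> 0" using join_commute[of r j'] cl by simp
  then have "m r \<le> 0" using j'r by (simp add: mle_def)
  then have "m q - m (p \<^bold>\<rightarrow> q) \<le> 0" using join1_eq[of p q] cl by (simp add: r_def)
  moreover have "m (p \<^bold>\<rightarrow> q) \<le> m q" using antimono le_imp1 cl by simp
  ultimately show ?thesis unfolding polar_def p_def[symmetric] q_def[symmetric] using cl by simp
qed

section \<open>Measure-morphisms\<close>

lemma measure_morphismI:
  assumes "\<And>x y. \<lbrakk>x \<in> carrier A; y \<in> carrier A\<rbrakk> \<Longrightarrow> m (x \<^bold>\<rightarrow> y) = 0 \<or> m (y \<^bold>\<rightarrow> x) = 0"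
  shows "measure_morphism A m"
  unfolding measure_morphism_def
proof (intro conjI ballI)
  fix x y assume cl: "x \<in> carrier A" "y \<in> carrier A"
  show "m (x \<^bold>\<rightarrow> y) = max 0 (m y - m x)"
    using assms[OF cl] join_commute[OF cl] cl nonneg[of "x \<^bold>\<rightarrow> y"] nonneg[of "y \<^bold>\<rightarrow> x"] by auto
  then show "m (x \<^bold>\<leadsto> y) = max 0 (m y - m x)"
    using imp1_imp2_same cl by simp
qed (rule nonneg)

lemma imp1_pow_morphism:
  assumes mor: "measure_morphism A m" and cl: "x \<in> carrier A" "y \<in> carrier A"
  shows "m (imp1_pow A n x y) = max 0 (m y - real n * m x)"
proof (induction n)
  case 0
  then show ?case using nonneg cl by simp
next
  case (Suc n)
  have "m (imp1_pow A (Suc n) x y) = max 0 (m (imp1_pow A n x y) - m x)"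
    using mor cl imp1_pow_closed unfolding measure_morphism_def by simp
  then show ?case using Suc nonneg[OF cl(1)] by (auto simp: algebra_simps max_def)
qed

text \<open>In lattice-ordered groups \<open>m - residual F\<close> is the part of \<open>m\<close> concentrated on \<open>F\<close>.\<close>

definition residual :: "'a set \<Rightarrow> 'a \<Rightarrow> real" where
  "residual F x = (INF c\<in>F. m (c \<^bold>\<rightarrow> x))"

context
  fixes F
  assumes F: "pbck_filter A F"
begin

lemma F_closed: "c \<in> F \<Longrightarrow> c \<in> carrier A"
  using F unfolding pbck_filter_def by blast

lemma F_nonempty: "F \<noteq> {}"
  using F unfolding pbck_filter_def by blast

lemma residual_le:
  assumes "x \<in> carrier A" "c \<in> F"
  shows "residual F x \<le> m (c \<^bold>\<rightarrow> x)"
  unfolding residual_def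
  by (rule cINF_lower[OF bdd_belowI2[where m = 0]]) (use assms F_closed nonneg in auto)

lemma residual_greatest:
  assumes "\<And>c. c \<in> F \<Longrightarrow> b \<le> m (c \<^bold>\<rightarrow> x)"
  shows "b \<le> residual F x"
  unfolding residual_def using F_nonempty assms by (rule cINF_greatest)

lemma residual_nonneg: "x \<in> carrier A \<Longrightarrow> 0 \<le> residual F x"
  by (rule residual_greatest) (use F_closed nonneg in auto)

lemma residual_le_measure: "x \<in> carrier A \<Longrightarrow> residual F x \<le> m x"
  using residual_le[of x \<one>] F one_imp1 unfolding pbck_filter_def by simp

lemma residual_filter:
  assumes "x \<in> F"
  shows "residual F x = 0"
  using residual_le[of x x] residual_nonneg[of x] le_iff_imp1[of x x] le_refl[of x]
    F_closed[OF assms] assms by simp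

text \<open>The element \<open>e\<close> below plays the role of the product of \<open>c\<close> and \<open>d\<close>, joined with \<open>y\<close>.\<close>

lemma residual_le_imp1_imp1:
  assumes "c \<in> F" "d \<in> F" "y \<in> carrier A"
  shows "residual F y \<le> m (c \<^bold>\<rightarrow> (d \<^bold>\<rightarrow> y))"
proof -
  define T where "T = c \<^bold>\<rightarrow> (d \<^bold>\<rightarrow> y)"
  define e where "e = T \<^bold>\<leadsto> y"
  have cl: "c \<in> carrier A" "d \<in> carrier A" "y \<in> carrier A" "T \<in> carrier A" "e \<in> carrier A"
    using assms F_closed by (auto simp: T_def e_def)
  have yT: "y \<sqsubseteq> T"
    using le_trans[of y "d \<^bold>\<rightarrow> y" T] le_imp1[of d y] le_imp1[of c "d \<^bold>\<rightarrow> y"] cl by (simp add: T_def)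
  \<comment> \<open>The exchange law pulls \<open>T\<close> out past \<open>d\<close> and then past
    \<open>c\<close>.\<close>
  have "c \<^bold>\<rightarrow> (d \<^bold>\<rightarrow> e) = T \<^bold>\<leadsto> T"
    using cl imp1_imp2_exchange[of d T y] imp1_imp2_exchange[of c T "d \<^bold>\<rightarrow> y"]
    by (simp add: e_def T_def)
  also have "\<dots> = \<one>" using le_iff_imp2[of T T] le_refl[of T] cl by simp
  finally have "c \<^bold>\<rightarrow> (d \<^bold>\<rightarrow> e) \<in> F" using F unfolding pbck_filter_def by simp
  then have "e \<in> F"
    using filter_mp[OF F] assms cl by (meson imp1_closed)
  moreover have "m (e \<^bold>\<rightarrow> y) = m T"
    using imp2_eq[of T y] imp1_eq[of e y] le_imp2[of T y] yT cl by (simp add: e_def)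
  ultimately show ?thesis using residual_le[of y e] cl by (simp add: T_def)
qed

text \<open>The two infima run over independent \<open>c\<close> and \<open>d\<close>. Exchange and
  the triangle inequality \<open>comp\<close> reduce the bound to
  \<open>residual_le_imp1_imp1\<close>, the substitute for closure of \<open>F\<close> under
  products.\<close>

lemma residual_le_add:
  assumes cl: "x \<in> carrier A" "y \<in> carrier A"
  shows "residual F y \<le> residual F (x \<^bold>\<rightarrow> y) + residual F x"
    and "residual F y \<le> residual F (x \<^bold>\<leadsto> y) + residual F x"
proof -
  have comp: "m (d \<^bold>\<rightarrow> v) \<le> m (d \<^bold>\<rightarrow> x) + m (x \<^bold>\<rightarrow> v)"
    if "d \<in> carrier A" "v \<in> carrier A" for d v
    using that cl antimono[OF _ _ imp1_le_imp1_imp1[of d x v]]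
      diff_le_imp1[of "d \<^bold>\<rightarrow> x" "d \<^bold>\<rightarrow> v"] by simp
  have add: "residual F y \<le> residual F w + residual F x"
    if bound: "\<And>c d. \<lbrakk>c \<in> F; d \<in> F\<rbrakk> \<Longrightarrow> residual F y \<le> m (c \<^bold>\<rightarrow> w) + m (d \<^bold>\<rightarrow> x)" for w
  proof -
    have "residual F y - m (c \<^bold>\<rightarrow> w) \<le> residual F x" if "c \<in> F" for c
      using bound[OF that]
      by (intro residual_greatest) (simp add: algebra_simps)
    then have "residual F y - residual F x \<le> residual F w"
      by (intro residual_greatest) (simp add: algebra_simps)
    then show ?thesis by simp
  qed
  show "residual F y \<le> residual F (x \<^bold>\<rightarrow> y) + residual F x"
  proof (rule add)
    fix c d assume cd: "c \<in> F" "d \<in> F"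
    note cd_cl = cd[THEN F_closed]
    have "m (c \<^bold>\<rightarrow> (x \<^bold>\<rightarrow> y)) = m (x \<^bold>\<rightarrow> (c \<^bold>\<leadsto> y))"
      using cl cd_cl imp1_imp2_same[of c "x \<^bold>\<rightarrow> y"] imp1_imp2_exchange[of x c y] by simp
    moreover have "m (d \<^bold>\<rightarrow> (c \<^bold>\<leadsto> y)) = m (c \<^bold>\<rightarrow> (d \<^bold>\<rightarrow> y))"
      using cl cd_cl imp1_imp2_same[of c "d \<^bold>\<rightarrow> y"] imp1_imp2_exchange[of d c y] by simp
    ultimately show "residual F y \<le> m (c \<^bold>\<rightarrow> (x \<^bold>\<rightarrow> y)) + m (d \<^bold>\<rightarrow> x)"
      using comp[of d "c \<^bold>\<leadsto> y"] residual_le_imp1_imp1[OF cd cl(2)] cl cd_cl by simp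
  qed
  show "residual F y \<le> residual F (x \<^bold>\<leadsto> y) + residual F x"
  proof (rule add)
    fix c d assume cd: "c \<in> F" "d \<in> F"
    note cd_cl = cd[THEN F_closed]
    have "m (c \<^bold>\<rightarrow> (x \<^bold>\<leadsto> y)) = m (x \<^bold>\<rightarrow> (c \<^bold>\<rightarrow> y))"
      using cl cd_cl imp1_imp2_same[of x "c \<^bold>\<rightarrow> y"] imp1_imp2_exchange[of c x y] by simp
    then show "residual F y \<le> m (c \<^bold>\<rightarrow> (x \<^bold>\<leadsto> y)) + m (d \<^bold>\<rightarrow> x)"
      using comp[of d "c \<^bold>\<rightarrow> y"] residual_le_imp1_imp1[OF cd(2,1) cl(2)] cl cd_cl by simp
  qed
qed

text \<open>Here one \<open>c\<close> serves both terms: replacing \<open>x\<close> by the larger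
  \<open>c \<leadsto> x\<close> or \<open>c \<rightarrow> x\<close> makes the arguments comparable,
  so that the measure of the arrow is a difference.\<close>

lemma residual_add_le:
  assumes cl: "x \<in> carrier A" "y \<in> carrier A" and yx: "y \<sqsubseteq> x"
  shows "residual F (x \<^bold>\<rightarrow> y) + residual F x \<le> residual F y"
    and "residual F (x \<^bold>\<leadsto> y) + residual F x \<le> residual F y"
proof -
  have add: "residual F w + residual F x \<le> residual F y"
    if w: "w \<in> carrier A"
      "\<And>c. c \<in> F \<Longrightarrow> m (c \<^bold>\<rightarrow> w) + m (c \<^bold>\<rightarrow> x) \<le> m (c \<^bold>\<rightarrow> y)" for w
    using w residual_le[of w] residual_le[of x] cl
    by (intro residual_greatest) (meson add_mono order_trans)
  show "residual F (x \<^bold>\<rightarrow> y) + residual F x \<le> residual F y"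
  proof (rule add)
    fix c assume "c \<in> F"
    note c = F_closed[OF this]
    have "m (c \<^bold>\<rightarrow> (x \<^bold>\<rightarrow> y)) = m (x \<^bold>\<rightarrow> (c \<^bold>\<leadsto> y))"
      using cl c imp1_imp2_same[of c "x \<^bold>\<rightarrow> y"] imp1_imp2_exchange[of x c y] by simp
    also have "\<dots> \<le> m ((c \<^bold>\<leadsto> x) \<^bold>\<rightarrow> (c \<^bold>\<leadsto> y))"
      using cl c antimono imp1_antimono le_imp2 by simp
    also have "\<dots> = m (c \<^bold>\<rightarrow> y) - m (c \<^bold>\<rightarrow> x)"
      using cl c yx imp1_eq imp2_mono imp1_imp2_same by simp
    finally show "m (c \<^bold>\<rightarrow> (x \<^bold>\<rightarrow> y)) + m (c \<^bold>\<rightarrow> x) \<le> m (c \<^bold>\<rightarrow> y)" by simp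
  qed (use cl in simp)
  show "residual F (x \<^bold>\<leadsto> y) + residual F x \<le> residual F y"
  proof (rule add)
    fix c assume "c \<in> F"
    note c = F_closed[OF this]
    have "m (c \<^bold>\<rightarrow> (x \<^bold>\<leadsto> y)) = m (x \<^bold>\<leadsto> (c \<^bold>\<rightarrow> y))"
      using cl c imp1_imp2_exchange[of c x y] by simp
    also have "\<dots> \<le> m ((c \<^bold>\<rightarrow> x) \<^bold>\<leadsto> (c \<^bold>\<rightarrow> y))"
      using cl c antimono imp2_antimono le_imp1 by simp
    also have "\<dots> = m (c \<^bold>\<rightarrow> y) - m (c \<^bold>\<rightarrow> x)"
      using cl c yx imp2_eq imp1_mono by simp
    finally show "m (c \<^bold>\<rightarrow> (x \<^bold>\<leadsto> y)) + m (c \<^bold>\<rightarrow> x) \<le> m (c \<^bold>\<rightarrow> y)" by simp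
  qed (use cl in simp)
qed

lemma residual_measure: "measure_on A (residual F)"
  unfolding measure_on_def
proof (intro conjI ballI impI)
  fix x y assume "x \<in> carrier A" "y \<in> carrier A" "y \<sqsubseteq> x"
  then show "residual F (x \<^bold>\<rightarrow> y) = residual F y - residual F x"
    and "residual F (x \<^bold>\<leadsto> y) = residual F y - residual F x"
    using residual_le_add residual_add_le by (smt (verit))+
qed (rule residual_nonneg)

end

end


section \<open>State-measures\<close>

lemma (in pseudo_bck) measure_on_scale:
  assumes "measure_on A m" "0 \<le> t"
  shows "measure_on A (\<lambda>x. t * m x)"
  using assms unfolding measure_on_def by (simp add: right_diff_distrib)

lemma (in pseudo_bck) measure_on_diff:
  assumes "measure_on A m" "measure_on A d" "\<And>x. x \<in> carrier A \<Longrightarrow> d x \<le> m x"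
  shows "measure_on A (\<lambda>x. m x - d x)"
  using assms unfolding measure_on_def by simp

locale pbck_state = unital_pseudo_bck A u + pbck_measure A m
  for A (structure) and u m +
  assumes m_unit: "m u = 1"
begin

lemma unit_closed: "u \<in> carrier A"
  using strong_unit unfolding strong_unit_def by blast

lemma measure_zero:
  assumes "measure_on A d" "d u = 0" "x \<in> carrier A"
  shows "d x = 0"
proof -
  interpret d: pbck_measure A d by unfold_locales (rule assms)
  show ?thesis
    using filter_unit_eq_carrier[OF d.filter_Ker0] assms unit_closed unfolding Ker0_def by blast
qed

lemma Ker0_proper: "Ker0 A m \<noteq> carrier A"
  using unit_closed m_unit unfolding Ker0_def by force

section \<open>Measure-morphisms and maximal kernels\<close>

lemma morphism_maximal:
  assumes mor: "measure_morphism A m"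
  shows "maximal_filter A (Ker0 A m)"
  unfolding maximal_filter_def
proof (intro conjI notI filter_Ker0 Ker0_proper; elim exE conjE)
  fix G assume G: "pbck_filter A G" "G \<noteq> carrier A" "Ker0 A m \<subset> G"
  then obtain a where a: "a \<in> G" "a \<in> carrier A" "m a \<noteq> 0"
    unfolding pbck_filter_def Ker0_def by blast
  then have "0 < m a" using nonneg[of a] by simp
  then obtain n where n: "1 < real n * m a" using reals_Archimedean3 by blast
  \<comment> \<open>Subtracting \<open>m a\<close> from \<open>m u = 1\<close> \<open>n\<close>
    times reaches 0.\<close>
  have "imp1_pow A n a u \<in> Ker0 A m"
    using imp1_pow_morphism[OF mor a(2) unit_closed] n m_unit a unit_closed
    unfolding Ker0_def by simp
  then have "u \<in> G" using filter_imp1_pow[OF G(1) a(1) unit_closed] G(3) by blast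
  then show False using filter_unit_eq_carrier G by blast
qed

text \<open>If neither \<open>p = x \<^bold>\<rightarrow> y\<close> nor \<open>q = y \<^bold>\<rightarrow> x\<close> is in the kernel, then the polar of \<open>q\<close> lies strictly
  between the kernel and the algebra.\<close>

lemma maximal_morphism:
  assumes dir: "downwards_directed A" and max: "maximal_filter A (Ker0 A m)"
  shows "measure_morphism A m"
proof (rule measure_morphismI)
  fix x y assume cl: "x \<in> carrier A" "y \<in> carrier A"
  then obtain z where "z \<in> carrier A" "z \<sqsubseteq> x" "z \<sqsubseteq> y"
    using dir unfolding downwards_directed_def by blast
  then have p: "x \<^bold>\<rightarrow> y \<in> polar (y \<^bold>\<rightarrow> x)" using prelinear cl by blast
  have q: "y \<^bold>\<rightarrow> x \<in> carrier A" using cl by simp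
  show "m (x \<^bold>\<rightarrow> y) = 0 \<or> m (y \<^bold>\<rightarrow> x) = 0"
  proof (cases "polar (y \<^bold>\<rightarrow> x) = carrier A")
    case True
    then show ?thesis using polar_self q by blast
  next
    case False
    then have "polar (y \<^bold>\<rightarrow> x) = Ker0 A m"
      using max filter_polar[OF q] Ker0_subset_polar[OF q] unfolding maximal_filter_def by blast
    then show ?thesis using p unfolding Ker0_def by blast
  qed
qed

section \<open>From extremality to measure-morphisms\<close>

text \<open>If \<open>t = d u\<close> were strictly between 0 and 1, \<open>m\<close> would be a
  mixture of \<open>d / t\<close> and \<open>(m - d) / (1 - t)\<close>, and extremality would give
  \<open>m a = d a / t = 0\<close>. If \<open>t\<close> were 1, \<open>m - d\<close> would vanish at
  \<open>u\<close>, hence everywhere.\<close>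

lemma extremal_dominated:
  assumes ext: "extremal_state_measure A u m"
    and d: "measure_on A d" "\<And>x. x \<in> carrier A \<Longrightarrow> d x \<le> m x"
    and a: "a \<in> carrier A" "d a = 0" "0 < m a" and x: "x \<in> carrier A"
  shows "d x = 0"
proof -
  define t where "t = d u"
  have md: "measure_on A (\<lambda>x. m x - d x)" using measure d by (rule measure_on_diff)
  have "0 \<le> t" using d(1) unit_closed unfolding t_def measure_on_def by blast
  moreover have "t \<le> 1" using d(2)[OF unit_closed] m_unit unfolding t_def by simp
  moreover have "t \<noteq> 1"
    using measure_zero[OF md _ a(1)] m_unit a unfolding t_def by auto
  moreover have "\<not> (0 < t \<and> t < 1)"
  proof
    assume t: "0 < t \<and> t < 1"
    define m1 where "m1 = (\<lambda>x. (1 / t) * d x)"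
    define m2 where "m2 = (\<lambda>x. (1 / (1 - t)) * (m x - d x))"
    have "state_measure A u m1"
      using measure_on_scale[OF d(1), of "1 / t"] t unfolding state_measure_def m1_def t_def by simp
    moreover have "state_measure A u m2"
      using measure_on_scale[OF md, of "1 / (1 - t)"] t m_unit unfolding state_measure_def m2_def t_def by simp
    moreover have "m x = t * m1 x + (1 - t) * m2 x" for x
      using t unfolding m1_def m2_def by simp
    ultimately have "m a = m1 a"
      using ext t a(1) unfolding extremal_state_measure_def by blast
    then show False using a unfolding m1_def by simp
  qed
  ultimately have "t = 0" by linarith
  then show ?thesis using measure_zero[OF d(1) _ x] unfolding t_def by simp
qed

text \<open>The measure \<open>residual (polar q)\<close> vanishes at \<open>p\<close> but keeps the
  value \<open>m q\<close> at \<open>q\<close>; if \<open>m p > 0\<close>, extremality forces it to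
  be 0.\<close>

lemma extremal_morphism:
  assumes dir: "downwards_directed A" and ext: "extremal_state_measure A u m"
  shows "measure_morphism A m"
proof (rule measure_morphismI)
  fix x y assume cl: "x \<in> carrier A" "y \<in> carrier A"
  then obtain z where z: "z \<in> carrier A" "z \<sqsubseteq> x" "z \<sqsubseteq> y"
    using dir unfolding downwards_directed_def by blast
  define p where "p = x \<^bold>\<rightarrow> y"
  define q where "q = y \<^bold>\<rightarrow> x"
  have pq: "p \<in> carrier A" "q \<in> carrier A" "p \<in> polar q"
    using prelinear cl z by (auto simp: p_def q_def)
  note F = filter_polar[OF pq(2)]
  have "m q = 0" if "0 < m p"
  proof -
    have "residual (polar q) q = 0"
      using extremal_dominated[OF ext residual_measure[OF F] residual_le_measure[OF F] pq(1) _ that pq(2)]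
        residual_filter[OF F pq(3)] by blast
    moreover have "m q \<le> residual (polar q) q"
      by (rule residual_greatest[OF F]) (simp add: polar_def)
    ultimately show ?thesis using nonneg pq by force
  qed
  then show "m (x \<^bold>\<rightarrow> y) = 0 \<or> m (y \<^bold>\<rightarrow> x) = 0"
    using nonneg[of p] pq unfolding p_def q_def by fastforce
qed

section \<open>Uniqueness and extremality of state-measure-morphisms\<close>

lemma morphism_imp1:
  "\<lbrakk>measure_morphism A m; x \<in> carrier A; y \<in> carrier A\<rbrakk> \<Longrightarrow> m (x \<^bold>\<rightarrow> y) = max 0 (m y - m x)"
  unfolding measure_morphism_def by blast

text \<open>The factor 1/2 absorbs the rounding of \<open>1 / m x\<close> to an integer. Values of
  \<open>m x\<close> above 1 are lowered by 1 through \<open>u \<rightarrow> x\<close>, hence the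
  induction on a bound for \<open>m x\<close>.\<close>

lemma morphism_lower_bound:
  assumes mor: "measure_morphism A m"
    and d: "measure_on A d" "Ker0 A m \<subseteq> Ker0 A d" and x: "x \<in> carrier A"
  shows "d u / 2 * m x \<le> d x"
proof -
  interpret d: pbck_measure A d by unfold_locales (rule d)
  have ker: "d y = 0" if "y \<in> carrier A" "m y = 0" for y
    using that d(2) unfolding Ker0_def by blast
  have du: "0 \<le> d u" using d.nonneg unit_closed by blast
  have "\<forall>x\<in>carrier A. m x \<le> real n \<longrightarrow> d u / 2 * m x \<le> d x" for n
  proof (induction n)
    case 0
    then show ?case using nonneg d.nonneg by (auto simp: order_antisym_conv)
  next
    case (Suc n)
    show ?case
    proof (intro ballI impI)
      fix x assume x: "x \<in> carrier A" "m x \<le> real (Suc n)"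
      consider "m x = 0" | "0 < m x" "m x \<le> 1" | "1 < m x" using nonneg[OF x(1)] by linarith
      then show "d u / 2 * m x \<le> d x"
      proof cases
        case 1
        then show ?thesis using d.nonneg x by simp
      next
        case 2
        \<comment> \<open>The least \<open>k\<close> with \<open>k * m x \<ge> 1\<close>, which
          sends \<open>imp1_pow A k x u\<close> into the kernel; \<open>m x \<le> 1\<close> keeps
          \<open>k * m x\<close> at most 2.\<close>
        define k where "k = nat \<lceil>1 / m x\<rceil>"
        have k: "1 / m x \<le> real k" "real k \<le> 1 / m x + 1"
          unfolding k_def using 2 by (auto intro: real_nat_ceiling_ge)
        have "1 \<le> real k * m x" using k 2 by (simp add: field_simps)
        then have "m (imp1_pow A k x u) = 0"
          using imp1_pow_morphism[OF mor x(1) unit_closed] m_unit by simp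
        then have "d (imp1_pow A k x u) = 0" using ker x unit_closed by simp
        then have "d u \<le> real k * d x"
          using d.diff_le_imp1_pow[of x u k] x unit_closed by simp
        then have "d u * m x \<le> real k * m x * d x"
          using 2 by (simp add: mult.assoc mult.left_commute mult_left_mono mult.commute)
        also have "\<dots> \<le> 2 * d x"
        proof (rule mult_right_mono)
          have "real k * m x \<le> (1 / m x + 1) * m x" using k 2 by (intro mult_right_mono) auto
          also have "\<dots> = 1 + m x" using 2 by (simp add: field_simps)
          finally show "real k * m x \<le> 2" using 2 by simp
        qed (use d.nonneg x in simp)
        finally show ?thesis by simp
      next
        case 3
        \<comment> \<open>Modulo the kernel \<open>x\<close> lies below \<open>u\<close>, so
          \<open>u \<rightarrow> x\<close> subtracts the value at \<open>u\<close> from both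
          \<open>m x\<close> and \<open>d x\<close>.\<close>
        have "m (x \<^bold>\<rightarrow> u) = 0" using morphism_imp1[OF mor x(1) unit_closed] 3 m_unit by simp
        then have "d (x \<^bold>\<rightarrow> u) = 0" using ker x unit_closed by simp
        then have dx: "d (u \<^bold>\<rightarrow> x) = d x - d u"
          using d.join_commute[of x u] x unit_closed by simp
        have mx: "m (u \<^bold>\<rightarrow> x) = m x - 1"
          using morphism_imp1[OF mor unit_closed x(1)] 3 m_unit by simp
        have "d u / 2 * m (u \<^bold>\<rightarrow> x) \<le> d (u \<^bold>\<rightarrow> x)"
          using Suc.IH[THEN bspec, of "u \<^bold>\<rightarrow> x"] x mx unit_closed by simp
        then show ?thesis using du unfolding dx mx by (simp add: field_simps)
      qed
    qed
  qed
  then show ?thesis using x real_arch_simple[of "m x"] by blast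
qed

text \<open>If \<open>s\<close> is the greatest number with \<open>s * m \<le> d\<close>, then the lower bound above, applied to
  \<open>d - s * m\<close>, shows that this measure vanishes at \<open>u\<close>.\<close>

lemma morphism_unique:
  assumes mor: "measure_morphism A m"
    and d: "measure_on A d" "Ker0 A m \<subseteq> Ker0 A d" and x: "x \<in> carrier A"
  shows "d x = d u * m x"
proof -
  define S where "S = {s. 0 \<le> s \<and> (\<forall>x\<in>carrier A. s * m x \<le> d x)}"
  have "0 \<in> S" using d unfolding S_def measure_on_def by simp
  have bdd: "bdd_above S"
    unfolding S_def using unit_closed m_unit by (intro bdd_aboveI[where M = "d u"]) force
  define s where "s = Sup S"
  have s0: "0 \<le> s" unfolding s_def using \<open>0 \<in> S\<close> bdd by (rule cSup_upper)
  have le: "s * m x \<le> d x" if x: "x \<in> carrier A" for x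
  proof (cases "m x = 0")
    case True
    then show ?thesis using \<open>0 \<in> S\<close> x unfolding S_def by auto
  next
    case False
    then have pos: "0 < m x" using nonneg[OF x] by simp
    have "s \<le> d x / m x"
      unfolding s_def using \<open>0 \<in> S\<close> x pos
      by (intro cSup_least) (auto simp: S_def field_simps)
    then show ?thesis using pos by (simp add: field_simps)
  qed
  define e where "e = (\<lambda>x. d x - s * m x)"
  have e_eq: "e x = d x - s * m x" for x
    by (simp add: e_def)
  have e: "measure_on A e"
    unfolding e_def by (rule measure_on_diff[OF d(1) measure_on_scale[OF measure s0] le])
  have "Ker0 A m \<subseteq> Ker0 A e"
    using d(2) by (auto simp: Ker0_def e_eq subset_iff)
  then have lower: "e u / 2 * m x \<le> e x" if "x \<in> carrier A" for x
    using morphism_lower_bound[OF mor e] that by blast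
  have eu: "0 \<le> e u" using e unit_closed unfolding measure_on_def by blast
  have "(s + e u / 2) * m x \<le> d x" if "x \<in> carrier A" for x
    using lower[OF that] unfolding e_eq distrib_right by simp
  then have "s + e u / 2 \<in> S"
    unfolding S_def using s0 eu by simp
  then have "s + e u / 2 \<le> s"
    unfolding s_def by (rule cSup_upper[OF _ bdd])
  then have "e u = 0" using eu by simp
  then have "e x = 0" using measure_zero[OF e _ x] by simp
  then show ?thesis using \<open>e u = 0\<close> m_unit by (simp add: e_eq)
qed

text \<open>The summands are nonnegative, so \<open>m1\<close> vanishes on the kernel of
  \<open>m\<close>; uniqueness with \<open>m1 u = 1\<close> gives \<open>m1 = m\<close> on the
  carrier, and \<open>m2\<close> follows by cancellation.\<close>

lemma morphism_extremal:
  assumes mor: "measure_morphism A m"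
  shows "extremal_state_measure A u m"
  unfolding extremal_state_measure_def
proof (intro conjI allI impI)
  show "state_measure A u m" unfolding state_measure_def using measure m_unit by simp
next
  fix m1 m2 t
  assume st: "state_measure A u m1" "state_measure A u m2" and t: "0 < t" "t < (1::real)"
    and eq: "\<forall>x\<in>carrier A. m x = t * m1 x + (1 - t) * m2 x"
  have nn: "0 \<le> m1 x" "0 \<le> m2 x" if "x \<in> carrier A" for x
    using st that unfolding state_measure_def measure_on_def by auto
  have "Ker0 A m \<subseteq> Ker0 A m1"
  proof
    fix x assume "x \<in> Ker0 A m"
    then have x: "x \<in> carrier A" "t * m1 x + (1 - t) * m2 x = 0" using eq unfolding Ker0_def by auto
    moreover have "0 \<le> t * m1 x" "0 \<le> (1 - t) * m2 x" using nn x t by auto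
    ultimately have "t * m1 x = 0" by linarith
    then show "x \<in> Ker0 A m1" using t x unfolding Ker0_def by simp
  qed
  then have m1: "m1 x = m x" if "x \<in> carrier A" for x
    using morphism_unique[OF mor _ _ that, of m1] st unfolding state_measure_def by simp
  show "\<forall>x\<in>carrier A. m x = m1 x \<and> m x = m2 x"
  proof
    fix x assume x: "x \<in> carrier A"
    then have "(1 - t) * (m x - m2 x) = 0" using eq m1 by (simp add: algebra_simps)
    then show "m x = m1 x \<and> m x = m2 x" using m1[OF x] t by simp
  qed
qed

lemma morphism_iff_maximal:
  "downwards_directed A \<Longrightarrow> measure_morphism A m \<longleftrightarrow> maximal_filter A (Ker0 A m)"
  using morphism_maximal maximal_morphism by blast

lemma morphism_iff_extremal:
  "downwards_directed A \<Longrightarrow> measure_morphism A m \<longleftrightarrow> extremal_state_measure A u m"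
  using morphism_extremal extremal_morphism by blast

section \<open>Passage between the algebra and the interval\<close>

text \<open>Stated for any \<open>m'\<close> agreeing with \<open>m\<close> on the interval, since
  \<open>restrict\<close> yields \<open>undefined\<close> elsewhere.\<close>

lemma upper_interval_state:
  assumes eq: "\<And>x. x \<in> carrier (upper_interval A u) \<Longrightarrow> m' x = m x"
  shows "pbck_state (upper_interval A u) u m'"
proof -
  let ?B = "upper_interval A u"
  interpret B: bounded_pseudo_bck ?B u
    using bounded_pseudo_bck_upper_interval unit_closed .
  have strong: "strong_unit ?B u"
    unfolding strong_unit_def
  proof (intro conjI ballI exI[of _ "1::nat"])
    fix a assume a: "a \<in> carrier ?B"
    then show "imp1_pow ?B 1 u a = \<one>\<^bsub>?B\<^esub>"
      using B.bot_le[OF a] B.le_iff_imp1[OF B.bot_closed a] by simp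
  qed (auto simp: B.bot_closed)
  have "measure_on ?B m'"
    unfolding measure_on_def
  proof (intro conjI ballI impI)
    fix x assume "x \<in> carrier ?B"
    then show "0 \<le> m' x" using eq nonneg by (simp add: upper_interval_def)
  next
    fix x y assume xy: "x \<in> carrier ?B" "y \<in> carrier ?B" "y \<sqsubseteq>\<^bsub>?B\<^esub> x"
    then show "m' (x \<^bold>\<rightarrow>\<^bsub>?B\<^esub> y) = m' y - m' x" "m' (x \<^bold>\<leadsto>\<^bsub>?B\<^esub> y) = m' y - m' x"
      using eq B.imp1_closed[of x y] B.imp2_closed[of x y] imp1_eq[of x y] imp2_eq[of x y]
      by (simp_all add: upper_interval_def)
  qed
  moreover have "m' u = 1" using eq[OF B.bot_closed] m_unit by simp
  ultimately show ?thesis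
    using strong by unfold_locales
qed

lemma upper_interval_morphism:
  assumes eq: "\<And>x. x \<in> carrier (upper_interval A u) \<Longrightarrow> m' x = m x"
    and mor: "measure_morphism A m"
  shows "measure_morphism (upper_interval A u) m'"
proof -
  let ?B = "upper_interval A u"
  interpret B: bounded_pseudo_bck ?B u
    using bounded_pseudo_bck_upper_interval unit_closed .
  show ?thesis
    unfolding measure_morphism_def
  proof (intro conjI ballI)
    fix x assume "x \<in> carrier ?B"
    then show "0 \<le> m' x" using eq nonneg by (simp add: upper_interval_def)
  next
    fix x y assume xy: "x \<in> carrier ?B" "y \<in> carrier ?B"
    then show "m' (x \<^bold>\<rightarrow>\<^bsub>?B\<^esub> y) = max 0 (m' y - m' x)" "m' (x \<^bold>\<leadsto>\<^bsub>?B\<^esub> y) = max 0 (m' y - m' x)"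
      using eq B.imp1_closed[of x y] B.imp2_closed[of x y] mor
      unfolding measure_morphism_def by (simp_all add: upper_interval_def)
  qed
qed

text \<open>A filter \<open>G\<close> strictly above \<open>Ker0 A m\<close> contains some \<open>a\<close> with \<open>m a > 0\<close>, hence also the join
  of \<open>u\<close> and \<open>a\<close>. That join has positive measure, since otherwise the polar of \<open>a\<close> would contain \<open>u\<close>.\<close>

lemma upper_interval_maximal:
  assumes eq: "\<And>x. x \<in> carrier (upper_interval A u) \<Longrightarrow> m' x = m x"
    and max: "maximal_filter (upper_interval A u) (Ker0 (upper_interval A u) m')"
  shows "maximal_filter A (Ker0 A m)"
  unfolding maximal_filter_def
proof (intro conjI notI filter_Ker0 Ker0_proper; elim exE conjE)
  let ?B = "upper_interval A u"
  have B: "x \<in> carrier ?B \<longleftrightarrow> x \<in> carrier A \<and> u \<sqsubseteq> x" for x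
    using le_one by (auto simp: upper_interval_def)
  fix G assume G: "pbck_filter A G" "G \<noteq> carrier A" "Ker0 A m \<subset> G"
  then obtain a where a: "a \<in> G" "a \<in> carrier A" "m a \<noteq> 0"
    unfolding pbck_filter_def Ker0_def by blast
  define b where "b = (u \<^bold>\<rightarrow> a) \<^bold>\<leadsto> a"
  have b: "b \<in> carrier A" "u \<sqsubseteq> b" "a \<sqsubseteq> b"
    using a unit_closed le_imp1_imp2 le_imp2 by (auto simp: b_def)
  have "m b \<noteq> 0"
  proof
    assume "m b = 0"
    then have "u \<in> polar a"
      using join1_eq[of u a] a unit_closed unfolding b_def polar_def by simp
    then have "a \<in> polar a"
      using filter_unit_eq_carrier[OF filter_polar] a by blast
    then show False using polar_self a by blast
  qed
  moreover have "b \<in> carrier ?B" using B b by simp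
  ultimately have "b \<notin> Ker0 ?B m'" "b \<in> G \<inter> carrier ?B"
    using eq[of b] filter_up[OF G(1) a(1) b(3,1)] unfolding Ker0_def by auto
  then have "Ker0 ?B m' \<noteq> G \<inter> carrier ?B" by blast
  moreover have "Ker0 ?B m' \<subseteq> G \<inter> carrier ?B"
    using G(3) eq B unfolding Ker0_def by auto
  moreover have "pbck_filter ?B (G \<inter> carrier ?B)"
    using G(1) le_one unit_closed unfolding pbck_filter_def by (simp add: upper_interval_def) blast
  ultimately have "G \<inter> carrier ?B = carrier ?B"
    using max unfolding maximal_filter_def by blast
  then have "u \<in> G" using B unit_closed le_refl by blast
  then show False using filter_unit_eq_carrier G by blast
qed

end

theorem theorem5p10:
  fixes A :: "('a, 'b) pbck_scheme" and u :: 'a and m m\<^sub>u :: "'a \<Rightarrow> real"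
  assumes "unital_pseudo_bck A u"
    and "downwards_directed A"
    and "state_measure A u m"
  defines "m\<^sub>u \<equiv> restrict m (carrier (upper_interval A u))"
  shows
    "(state_measure_morphism A u m \<longleftrightarrow> state_measure_morphism (upper_interval A u) u m\<^sub>u) \<and>
     (state_measure_morphism A u m \<longleftrightarrow> maximal_filter A (Ker0 A m)) \<and>
     (state_measure_morphism A u m \<longleftrightarrow>
        maximal_filter (upper_interval A u) (Ker0 (upper_interval A u) m\<^sub>u)) \<and>
     (state_measure_morphism A u m \<longleftrightarrow> extremal_state_measure A u m) \<and>
     (state_measure_morphism A u m \<longleftrightarrow> extremal_state_measure (upper_interval A u) u m\<^sub>u)"
proof -
  let ?B = "upper_interval A u"
  interpret unital_pseudo_bck A u by fact
  interpret pbck_state A u m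
    using assms(3) unfolding state_measure_def by unfold_locales auto
  have eq: "\<And>x. x \<in> carrier ?B \<Longrightarrow> m\<^sub>u x = m x"
    unfolding m\<^sub>u_def by simp
  interpret B: bounded_pseudo_bck ?B u
    using bounded_pseudo_bck_upper_interval unit_closed .
  interpret B: pbck_state ?B u m\<^sub>u
    using upper_interval_state eq .
  have dirB: "downwards_directed ?B"
    unfolding downwards_directed_def using B.bot_closed B.bot_le by blast
  have stB: "state_measure ?B u m\<^sub>u"
    unfolding state_measure_def using B.measure B.m_unit by simp
  \<comment> \<open>The equivalences hold on \<open>A\<close> and on \<open>[u, 1]\<close>
    separately; restriction carries morphisms down and \<open>upper_interval_maximal\<close> carries
    maximality up, which joins the two groups.\<close>
  show ?thesis
    using upper_interval_morphism[OF eq] upper_interval_maximal[OF eq]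
      morphism_iff_maximal[OF assms(2)] morphism_iff_extremal[OF assms(2)]
      B.morphism_iff_maximal[OF dirB] B.morphism_iff_extremal[OF dirB] assms(3) stB
    unfolding state_measure_morphism_def by blast
qed

end
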